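(* Let $(X_i)_{i\in\mathbb{N}}$ be a sequence of iid random variables taking values in $\mathbb{N}_0=\{0,1,2,\dots\}$ such that $\mathbb{E}[X_1]\le1$ and $\mathbb{V}[X_1]<\infty$. Let $r\in\mathbb{N}$ and set $S_t:=\sum_{i=1}^t(X_i-1)$ for $t\in\mathbb{N}$. Suppose that $\mathbb{P}(X_1=r+1)>0$ and set $c_r:=\mathbb{P}(X_1=r+1)^{-1}$. Then, for every $k\in\mathbb{N}$, $$\mathbb{P}(r+S_t>0\ \ \forall t\le k)\le\frac{c_r(1+2\mathbb{V}[X_1])}{k^{1/2}}.$$
   Context: $\mathbb{N}=\{1,2,\dots\}$; $\mathbb{V}$ denotes variance; "$\forall t\le k$" means for all $t\in\{1,\dots,k\}$. *)

theory Defs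
  imports "HOL-Probability.Probability"
begin

definition iid_on :: "'a measure \<Rightarrow> 'b measure \<Rightarrow> ('i \<Rightarrow> 'a \<Rightarrow> 'b) \<Rightarrow> 'i set \<Rightarrow> bool" where
  "iid_on M N X I \<longleftrightarrow>
     prob_space.indep_vars M (\<lambda>_. N) X I \<and>
     (\<forall>i\<in>I. \<forall>j\<in>I. distr M N (X i) = distr M N (X j))"

(* Integer-valued, so that the subtraction of 1 is not truncated. *)
definition step_walk :: "(nat \<Rightarrow> 'a \<Rightarrow> nat) \<Rightarrow> nat \<Rightarrow> 'a \<Rightarrow> int" where
  "step_walk X t \<omega> = (\<Sum>i=1..t. (int (X i \<omega>) - 1))"

(* Finiteness of the mean is required because the Bochner integral of a
   non-integrable function is 0. *)
definition finite_variance :: "'a measure \<Rightarrow> ('a \<Rightarrow> real) \<Rightarrow> bool" where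
  "finite_variance M Y \<longleftrightarrow>
     integrable M Y \<and> integrable M (\<lambda>\<omega>. (Y \<omega> - prob_space.expectation M Y)\<^sup>2)"

end

theory Submission
  imports Defs
begin

text \<open>
  Let \<open>T\<close> be the first time at which the walk started at \<open>r\<close> is at \<open>0\<close>; as the steps are at least
  \<open>-1\<close>, it cannot pass \<open>0\<close> without hitting it. For \<open>0 < z \<le> 1\<close> put \<open>\<psi> = E[z^X] / z\<close>. Then
  \<open>\<psi>^(-t) z^(r + S_t)\<close> is a martingale, and if \<open>\<psi> \<ge> 1\<close>, stopping it at \<open>min T k\<close> gives
  \<open>z^r \<le> P(T \<le> k) + \<psi>^(-k) P(T > k)\<close>, that is
  \<open>P(T > k) (1 - \<psi>^(-k)) \<le> 1 - z^r\<close>.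

  A mean of at most \<open>1\<close> makes \<open>\<psi>\<close> exceed \<open>1\<close> by a quadratic amount: the tangent-line bound
  \<open>z^(j - 1) \<ge> 1 - (j - 1)(1 - z)\<close> for \<open>j \<ge> 1\<close>, together with the second-order gain at \<open>j = 0\<close>, yields
  \<open>\<psi> \<ge> 1 + a (1 - z)^2\<close> with \<open>a = P(X = 0)\<close> (lemma \<open>generating_function_lower_bound\<close>). With
  \<open>1 - z = k^(-1/2)\<close> this gives \<open>\<psi>^k \<ge> 1 + a\<close>, and so
  \<open>P(T > k) \<le> r (1 + 1/a) k^(-1/2)\<close> (lemma \<open>survival_bound\<close>).

  It remains to trade \<open>r\<close> and \<open>1/a\<close> for \<open>q = P(X = r + 1)\<close> and the variance. The upward drift \<open>r q\<close>
  contributed by the value \<open>r + 1\<close> must be balanced by the downward steps, so \<open>r q \<le> a\<close>; and that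
  value lies at distance at least \<open>r\<close> from the mean, so \<open>r q \<le> V\<close>. Hence
  \<open>q r (1 + 1/a) = r q + r q / a \<le> V + 1\<close>.
\<close>

section \<open>A single step\<close>

text \<open>
  For \<open>j > 0\<close> this is Bernoulli's inequality for the exponent \<open>j - 1\<close>. The exponent \<open>-1\<close> at \<open>j = 0\<close>
  is what produces a second-order term, the remainder of \<open>1 / z\<close> over its tangent at \<open>1\<close> being
  \<open>(1 - z)^2 / z\<close>.
\<close>
lemma power_div_self_lower_bound:
  fixes z :: real
  assumes "0 < z" "z \<le> 1"
  shows "1 - (real j - 1) * (1 - z) + (1 - z)\<^sup>2 * (if j = 0 then 1 else 0) \<le> z ^ j / z"
proof (cases j)
  case 0
  have "(1 + (1 - z) + (1 - z)\<^sup>2) * z = 1 - (1 - z) ^ 3"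
    by (simp add: power2_eq_square power3_eq_cube algebra_simps)
  also have "\<dots> \<le> 1"
    using assms by simp
  finally show ?thesis
    using 0 assms by (simp add: pos_le_divide_eq)
next
  case (Suc i)
  have "1 + real i * (z - 1) \<le> (1 + (z - 1)) ^ i"
    using assms by (intro Bernoulli_inequality) simp
  then show ?thesis
    using Suc assms by (simp add: algebra_simps)
qed

context prob_space
begin

text \<open>
  The linear term of the pointwise bound integrates to a nonnegative quantity because the step
  \<open>Y - 1\<close> has nonpositive mean, so only the quadratic gain at \<open>Y = 0\<close> remains.
\<close>
lemma generating_function_lower_bound:
  fixes Y :: "'a \<Rightarrow> nat" and z :: real
  assumes Y [measurable]: "Y \<in> measurable M (count_space UNIV)"
    and int: "integrable M (\<lambda>\<omega>. real (Y \<omega>))"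
    and mean: "expectation (\<lambda>\<omega>. real (Y \<omega>)) \<le> 1"
    and z: "0 < z" "z \<le> 1"
  shows "1 + prob {\<omega> \<in> space M. Y \<omega> = 0} * (1 - z)\<^sup>2 \<le> expectation (\<lambda>\<omega>. z ^ Y \<omega>) / z"
proof -
  let ?I = "indicator {\<omega> \<in> space M. Y \<omega> = 0} :: 'a \<Rightarrow> real"
  have int_pow: "integrable M (\<lambda>\<omega>. z ^ Y \<omega>)"
    by (rule integrable_const_bound[where B = 1]) (use z in \<open>auto simp: power_le_one\<close>)
  have int_I: "integrable M ?I"
    by (rule integrable_const_bound[where B = 1]) auto
  have "1 + prob {\<omega> \<in> space M. Y \<omega> = 0} * (1 - z)\<^sup>2
      \<le> 1 - (expectation (\<lambda>\<omega>. real (Y \<omega>)) - 1) * (1 - z)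
          + (1 - z)\<^sup>2 * prob {\<omega> \<in> space M. Y \<omega> = 0}"
    using mean z by (simp add: mult_nonpos_nonneg)
  also have "\<dots> = expectation (\<lambda>\<omega>. 1 - (real (Y \<omega>) - 1) * (1 - z) + (1 - z)\<^sup>2 * ?I \<omega>)"
    using int int_I by (simp add: prob_space)
  also have "\<dots> \<le> expectation (\<lambda>\<omega>. z ^ Y \<omega> / z)"
  proof (rule integral_mono)
    fix \<omega> assume "\<omega> \<in> space M"
    then have "?I \<omega> = (if Y \<omega> = 0 then 1 else 0)"
      by simp
    then show "1 - (real (Y \<omega>) - 1) * (1 - z) + (1 - z)\<^sup>2 * ?I \<omega> \<le> z ^ Y \<omega> / z"
      using power_div_self_lower_bound[OF z, of "Y \<omega>"] by presburger
  qed (use int int_I int_pow in auto)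
  finally show ?thesis
    by simp
qed

text \<open>
  Only the value \<open>0\<close> gives a negative step, and that step is \<open>-1\<close>. Since the mean step is at most \<open>0\<close>,
  this single atom outweighs every upward contribution.
\<close>
lemma upward_mass_le_prob_zero:
  fixes Y :: "'a \<Rightarrow> nat"
  assumes Y [measurable]: "Y \<in> measurable M (count_space UNIV)"
    and int: "integrable M (\<lambda>\<omega>. real (Y \<omega>))"
    and mean: "expectation (\<lambda>\<omega>. real (Y \<omega>)) \<le> 1"
  shows "real r * prob {\<omega> \<in> space M. Y \<omega> = r + 1} \<le> prob {\<omega> \<in> space M. Y \<omega> = 0}"
proof -
  let ?I = "\<lambda>j. indicator {\<omega> \<in> space M. Y \<omega> = j} :: 'a \<Rightarrow> real"
  have int_I: "integrable M (?I j)" for j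
    by (rule integrable_const_bound[where B = 1]) auto
  have "real r * prob {\<omega> \<in> space M. Y \<omega> = r + 1} - prob {\<omega> \<in> space M. Y \<omega> = 0}
      = expectation (\<lambda>\<omega>. real r * ?I (r + 1) \<omega> - ?I 0 \<omega>)"
    using int_I[of 0] int_I[of "r + 1"] by simp
  also have "\<dots> \<le> expectation (\<lambda>\<omega>. real (Y \<omega>) - 1)"
  proof (rule integral_mono)
    show "integrable M (\<lambda>\<omega>. real r * ?I (r + 1) \<omega> - ?I 0 \<omega>)"
      using int_I by (intro Bochner_Integration.integrable_diff integrable_mult_right)
  qed (use int in \<open>auto simp: indicator_def\<close>)
  also have "\<dots> \<le> 0"
    using int mean by (simp add: prob_space)
  finally show ?thesis
    by simp
qed

text \<open>
  Since the mean is at most \<open>1\<close>, the value \<open>r + 1\<close> deviates from it by at least \<open>r\<close> and adds at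
  least \<open>r^2 q\<close> to the variance; for an integer \<open>r\<close> this is at least \<open>r q\<close>.
\<close>
lemma upward_mass_le_variance:
  fixes Y :: "'a \<Rightarrow> nat"
  assumes Y [measurable]: "Y \<in> measurable M (count_space UNIV)"
    and fin: "finite_variance M (\<lambda>\<omega>. real (Y \<omega>))"
    and mean: "expectation (\<lambda>\<omega>. real (Y \<omega>)) \<le> 1"
  shows "real r * prob {\<omega> \<in> space M. Y \<omega> = r + 1} \<le> variance (\<lambda>\<omega>. real (Y \<omega>))"
proof -
  let ?m = "expectation (\<lambda>\<omega>. real (Y \<omega>))"
  let ?I = "indicator {\<omega> \<in> space M. Y \<omega> = r + 1} :: 'a \<Rightarrow> real"
  have int_I: "integrable M ?I"
    by (rule integrable_const_bound[where B = 1]) auto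
  have "real r \<le> (real r)\<^sup>2"
    by (cases r) (auto simp: power2_eq_square)
  also have "\<dots> \<le> (real (r + 1) - ?m)\<^sup>2"
    using mean by (intro power_mono) auto
  finally have r: "real r \<le> (real (r + 1) - ?m)\<^sup>2" .
  have "real r * prob {\<omega> \<in> space M. Y \<omega> = r + 1} = expectation (\<lambda>\<omega>. real r * ?I \<omega>)"
    by simp
  also have "\<dots> \<le> variance (\<lambda>\<omega>. real (Y \<omega>))"
  proof (rule integral_mono)
    show "integrable M (\<lambda>\<omega>. (real (Y \<omega>) - ?m)\<^sup>2)"
      using fin by (simp add: finite_variance_def)
    show "integrable M (\<lambda>\<omega>. real r * ?I \<omega>)"
      using int_I by (rule integrable_mult_right)
  qed (use r in \<open>auto simp: indicator_def\<close>)
  finally show ?thesis .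
qed

end

section \<open>The exponential weight of the surviving walk\<close>

definition survival :: "'a measure \<Rightarrow> (nat \<Rightarrow> 'a \<Rightarrow> nat) \<Rightarrow> nat \<Rightarrow> nat \<Rightarrow> 'a set" where
  "survival M X r t = {\<omega> \<in> space M. \<forall>s\<in>{1..t}. int r + step_walk X s \<omega> > 0}"

text \<open>
  The exponential \<open>z^(r + S_t)\<close>, set to \<open>0\<close> once the walk has been absorbed, but without the
  normalising factor \<open>\<psi>^(-t)\<close>. It takes no measure as argument, so that it can also be read as a
  function of the finite sequence \<open>(X_1, ..., X_t)\<close>, which is how independence of the next step enters.
\<close>
definition surviving_weight :: "(nat \<Rightarrow> 'a \<Rightarrow> nat) \<Rightarrow> nat \<Rightarrow> real \<Rightarrow> nat \<Rightarrow> 'a \<Rightarrow> real" where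
  "surviving_weight X r z t \<omega> =
     (if \<forall>s\<in>{1..t}. int r + step_walk X s \<omega> > 0 then z ^ nat (int r + step_walk X t \<omega>) else 0)"

lemma step_walk_0 [simp]: "step_walk X 0 \<omega> = 0"
  by (simp add: step_walk_def)

lemma step_walk_Suc: "step_walk X (Suc t) \<omega> = step_walk X t \<omega> + (int (X (Suc t) \<omega>) - 1)"
  by (simp add: step_walk_def)

lemma measurable_step_walk:
  assumes "\<And>i. i \<in> {1..t} \<Longrightarrow> X i \<in> measurable M (count_space UNIV)"
  shows "step_walk X t \<in> measurable M (count_space UNIV)"
  using assms
proof (induction t)
  case (Suc t)
  then have [measurable]: "step_walk X t \<in> measurable M (count_space UNIV)"
      "X (Suc t) \<in> measurable M (count_space UNIV)"
    by auto
  show ?case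
    unfolding step_walk_Suc[abs_def] by measurable
qed (simp add: step_walk_def[abs_def])

lemma measurable_survives:
  assumes "\<And>i. i \<in> {1..t} \<Longrightarrow> X i \<in> measurable M (count_space UNIV)"
  shows "Measurable.pred M (\<lambda>\<omega>. \<forall>s\<in>{1..t}. int r + step_walk X s \<omega> > 0)"
proof (rule pred_intros_finite)
  fix s assume "s \<in> {1..t}"
  then have "step_walk X s \<in> measurable M (count_space UNIV)"
    by (intro measurable_step_walk) (use assms in auto)
  then show "Measurable.pred M (\<lambda>\<omega>. int r + step_walk X s \<omega> > 0)"
    by (rule measurable_compose) simp
qed simp

lemma measurable_surviving_weight:
  assumes "\<And>i. i \<in> {1..t} \<Longrightarrow> X i \<in> measurable M (count_space UNIV)"
  shows "surviving_weight X r z t \<in> borel_measurable M"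
proof -
  have [measurable]: "step_walk X t \<in> measurable M (count_space UNIV)"
    by (rule measurable_step_walk) (rule assms)
  have [measurable]: "Measurable.pred M (\<lambda>\<omega>. \<forall>s\<in>{1..t}. int r + step_walk X s \<omega> > 0)"
    by (rule measurable_survives) (rule assms)
  show ?thesis
    unfolding surviving_weight_def[abs_def] by measurable
qed

lemma surviving_weight_bounds:
  assumes "0 \<le> z" "z \<le> 1"
  shows "0 \<le> surviving_weight X r z t \<omega>" "surviving_weight X r z t \<omega> \<le> 1"
  using assms by (auto simp: surviving_weight_def power_le_one)

text \<open>
  A walk alive at time \<open>t\<close> is at height at least \<open>1\<close>. Multiplying by \<open>z^(X - 1)\<close> moves its weight to the new
  height; if it dies in this step, it does so at height exactly \<open>0\<close>, where the weight is \<open>z^0 = 1\<close>.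
  The difference of indicators accounts for these newly absorbed paths.
\<close>
lemma surviving_weight_step:
  assumes "r \<ge> 1" "z > 0" "\<omega> \<in> space M"
  shows "surviving_weight X r z t \<omega> * (z ^ X (Suc t) \<omega> / z)
    = surviving_weight X r z (Suc t) \<omega>
      + (indicator (survival M X r t) \<omega> - indicator (survival M X r (Suc t)) \<omega>)"
proof (cases "\<omega> \<in> survival M X r t")
  case True
  let ?h = "int r + step_walk X t \<omega>"
  have pos: "?h \<ge> 1"
  proof (cases "t = 0")
    case False
    then have "?h > 0"
      using True by (simp add: survival_def)
    then show ?thesis
      by simp
  qed (use assms(1) in simp)
  \<comment> \<open>Writing the height as a successor turns the exponent \<open>X - 1\<close> into natural-number arithmetic.\<close>
  define n where "n = nat ?h - 1"
  have n: "?h = int (Suc n)"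
    using pos by (simp add: n_def)
  have h': "int r + step_walk X (Suc t) \<omega> = int (n + X (Suc t) \<omega>)"
    using n by (simp add: step_walk_Suc)
  have alive: "\<forall>s\<in>{1..t}. int r + step_walk X s \<omega> > 0"
    using True by (simp add: survival_def)
  have alive': "(\<forall>s\<in>{1..Suc t}. int r + step_walk X s \<omega> > 0) \<longleftrightarrow> n + X (Suc t) \<omega> > 0"
    using alive h' by (auto simp: atLeastAtMostSuc_conv)
  have "surviving_weight X r z t \<omega> * (z ^ X (Suc t) \<omega> / z) = z ^ (n + X (Suc t) \<omega>)"
    unfolding surviving_weight_def using alive n assms(2) by (simp add: power_add del: of_nat_Suc)
  then show ?thesis
    using True alive' h' assms(3)
    by (simp add: surviving_weight_def survival_def indicator_def del: of_nat_add)
next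
  case False
  then have "\<not> (\<forall>s\<in>{1..t}. int r + step_walk X s \<omega> > 0)"
    "\<not> (\<forall>s\<in>{1..Suc t}. int r + step_walk X s \<omega> > 0)"
    using assms(3) by (auto simp: survival_def)
  then show ?thesis
    unfolding surviving_weight_def survival_def indicator_def by auto
qed

section \<open>Survival probabilities\<close>

context prob_space
begin

lemma surviving_weight_indep_next_step:
  assumes indep: "indep_vars (\<lambda>_. count_space UNIV) X {1..}"
    and z: "0 \<le> z" "z \<le> 1"
  shows "expectation (\<lambda>\<omega>. surviving_weight X r z t \<omega> * z ^ X (Suc t) \<omega>)
    = expectation (surviving_weight X r z t) * expectation (\<lambda>\<omega>. z ^ X (Suc t) \<omega>)"
proof -
  let ?N = "\<lambda>_ :: nat. count_space (UNIV :: nat set)"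
  have X: "X i \<in> measurable M (count_space UNIV)" if "i \<ge> 1" for i
    using indep that by (auto simp: indep_vars_def)
  have step_walk_restrict:
    "step_walk X s \<omega> = step_walk (\<lambda>i f. f i) s (restrict (\<lambda>i. X i \<omega>) {1..t})"
    if "s \<le> t" for s \<omega>
    using that by (auto simp: step_walk_def intro!: sum.cong)
  have past: "surviving_weight X r z t
      = surviving_weight (\<lambda>i f. f i) r z t \<circ> (\<lambda>\<omega>. restrict (\<lambda>i. X i \<omega>) {1..t})"
  proof (rule ext)
    fix \<omega>
    have "(\<forall>s\<in>{1..t}. int r + step_walk (\<lambda>i f. f i) s (restrict (\<lambda>i. X i \<omega>) {1..t}) > 0)
        \<longleftrightarrow> (\<forall>s\<in>{1..t}. int r + step_walk X s \<omega> > 0)"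
      by (intro ball_cong) (simp_all only: step_walk_restrict atLeastAtMost_iff)
    then show "surviving_weight X r z t \<omega>
        = (surviving_weight (\<lambda>i f. f i) r z t \<circ> (\<lambda>\<omega>. restrict (\<lambda>i. X i \<omega>) {1..t})) \<omega>"
      by (simp only: surviving_weight_def o_def step_walk_restrict[OF order_refl, of \<omega>])
  qed
  have future: "(\<lambda>\<omega>. z ^ X (Suc t) \<omega>)
      = (\<lambda>f. z ^ f (Suc t)) \<circ> (\<lambda>\<omega>. restrict (\<lambda>i. X i \<omega>) {Suc t})"
    by (auto simp: fun_eq_iff)
  have "indep_var borel (surviving_weight X r z t) borel (\<lambda>\<omega>. z ^ X (Suc t) \<omega>)"
    unfolding past future
  proof (rule indep_var_compose)
    show "indep_var (PiM {1..t} ?N) (\<lambda>\<omega>. restrict (\<lambda>i. X i \<omega>) {1..t})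
        (PiM {Suc t} ?N) (\<lambda>\<omega>. restrict (\<lambda>i. X i \<omega>) {Suc t})"
      by (rule indep_var_restrict[OF indep]) auto
    show "surviving_weight (\<lambda>i f. f i) r z t \<in> borel_measurable (PiM {1..t} ?N)"
      by (rule measurable_surviving_weight) (rule measurable_component_singleton)
    have [measurable]: "(\<lambda>f. f (Suc t)) \<in> measurable (PiM {Suc t} ?N) (count_space UNIV)"
      by (rule measurable_component_singleton) simp
    show "(\<lambda>f. z ^ f (Suc t)) \<in> borel_measurable (PiM {Suc t} ?N)"
      by measurable
  qed
  moreover have "integrable M (surviving_weight X r z t)"
    by (rule integrable_const_bound[where B = 1])
      (use z X in \<open>auto simp: surviving_weight_bounds intro!: measurable_surviving_weight\<close>)
  moreover have "integrable M (\<lambda>\<omega>. z ^ X (Suc t) \<omega>)"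
  proof (rule integrable_const_bound[where B = 1])
    have [measurable]: "X (Suc t) \<in> measurable M (count_space UNIV)"
      by (rule X) simp
    show "(\<lambda>\<omega>. z ^ X (Suc t) \<omega>) \<in> borel_measurable M"
      by measurable
  qed (use z in \<open>auto simp: power_le_one\<close>)
  ultimately show ?thesis
    by (rule indep_var_lebesgue_integral)
qed

lemma survival_measurable:
  assumes "\<And>i. i \<ge> 1 \<Longrightarrow> X i \<in> measurable M (count_space UNIV)"
  shows "survival M X r t \<in> events"
proof -
  have [measurable]: "Measurable.pred M (\<lambda>\<omega>. \<forall>s\<in>{1..t}. int r + step_walk X s \<omega> > 0)"
    by (rule measurable_survives) (use assms in auto)
  show ?thesis
    unfolding survival_def by measurable
qed

text \<open>
  Optional stopping at a bounded time, carried out as a recursion. Let \<open>w t\<close> be the expected surviving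
  weight and \<open>p t\<close> the survival probability. By independence
  \<open>w (t + 1) = \<psi> w t - (p t - p (t + 1))\<close>, and the paths absorbed at time \<open>t + 1\<close> count at most
  \<open>\<psi>^(t + 1)\<close> times their mass, since \<open>\<psi> \<ge> 1\<close>. Induction gives \<open>w t \<ge> \<psi>^t (z^r - (1 - p t))\<close>, while
  \<open>w t \<le> p t\<close> because weights are at most \<open>1\<close>.
\<close>
lemma survival_exponential_bound:
  assumes iid: "iid_on M (count_space UNIV) X {1..}"
    and r: "r \<ge> 1" and z: "0 < z" "z \<le> 1"
    and \<psi>: "\<psi> = expectation (\<lambda>\<omega>. z ^ X 1 \<omega>) / z" "\<psi> \<ge> 1"
  shows "\<psi> ^ t * (z ^ r - 1 + prob (survival M X r t)) \<le> prob (survival M X r t)"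
proof -
  let ?W = "surviving_weight X r z" and ?A = "survival M X r"
  have indep: "indep_vars (\<lambda>_. count_space UNIV) X {1..}"
    using iid by (simp add: iid_on_def)
  have X: "X i \<in> measurable M (count_space UNIV)" if "i \<ge> 1" for i
    using indep that by (auto simp: indep_vars_def)
  have A [measurable]: "?A t \<in> events" for t
    by (rule survival_measurable) (rule X)
  have int_W: "integrable M (?W t)" for t
    by (rule integrable_const_bound[where B = 1])
      (use z X in \<open>auto simp: surviving_weight_bounds intro!: measurable_surviving_weight\<close>)
  have int_A: "integrable M (indicator (?A t) :: 'a \<Rightarrow> real)" for t
    by (rule integrable_const_bound[where B = 1]) auto
  have same: "expectation (\<lambda>\<omega>. z ^ X (Suc t) \<omega>) = expectation (\<lambda>\<omega>. z ^ X 1 \<omega>)" for t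
  proof -
    have eq: "distr M (count_space UNIV) (X (Suc t)) = distr M (count_space UNIV) (X 1)"
      using iid unfolding iid_on_def by (metis One_nat_def atLeast_iff le_add1 order_refl plus_1_eq_Suc)
    have "expectation (\<lambda>\<omega>. z ^ X i \<omega>) = (\<integral>j. z ^ j \<partial>distr M (count_space UNIV) (X i))"
      if "i \<ge> 1" for i
      using X[OF that] by (simp add: integral_distr)
    then show ?thesis
      using eq by simp
  qed
  have step: "expectation (?W (Suc t)) = \<psi> * expectation (?W t) - (prob (?A t) - prob (?A (Suc t)))"
    for t
  proof -
    have "\<psi> * expectation (?W t) = expectation (\<lambda>\<omega>. ?W t \<omega> * z ^ X (Suc t) \<omega>) / z"
      using surviving_weight_indep_next_step[OF indep, of z r t] z
      unfolding \<psi>(1) same[of t] by simp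
    also have "\<dots> = expectation (\<lambda>\<omega>. ?W t \<omega> * (z ^ X (Suc t) \<omega> / z))"
      by simp
    also have "\<dots> = expectation (\<lambda>\<omega>. ?W (Suc t) \<omega> + (indicator (?A t) \<omega> - indicator (?A (Suc t)) \<omega>))"
      using surviving_weight_step[OF r z(1)] by (intro Bochner_Integration.integral_cong) auto
    also have "\<dots> = expectation (?W (Suc t)) + (prob (?A t) - prob (?A (Suc t)))"
      using int_W[of "Suc t"] int_A[of t] int_A[of "Suc t"] by simp
    finally show ?thesis
      by simp
  qed
  have "\<psi> ^ t * (z ^ r - 1 + prob (?A t)) \<le> expectation (?W t)"
  proof (induction t)
    case 0
    show ?case
      by (simp add: surviving_weight_def survival_def prob_space)
  next
    case (Suc t)
    have "?A (Suc t) \<subseteq> ?A t"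
      by (auto simp: survival_def)
    then have decr: "prob (?A (Suc t)) \<le> prob (?A t)"
      by (intro finite_measure_mono) auto
    have "\<psi> ^ Suc t * (z ^ r - 1 + prob (?A (Suc t)))
        = \<psi> ^ Suc t * (z ^ r - 1 + prob (?A t)) - \<psi> ^ Suc t * (prob (?A t) - prob (?A (Suc t)))"
      by (simp add: algebra_simps)
    also have "\<dots> \<le> \<psi> ^ Suc t * (z ^ r - 1 + prob (?A t)) - (prob (?A t) - prob (?A (Suc t)))"
      using mult_right_mono[OF one_le_power[OF \<psi>(2), of "Suc t"], of "prob (?A t) - prob (?A (Suc t))"]
        decr by simp
    also have "\<dots> \<le> \<psi> * expectation (?W t) - (prob (?A t) - prob (?A (Suc t)))"
      using mult_left_mono[OF Suc, of \<psi>] \<psi>(2) by (simp add: mult.assoc)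
    finally show ?case
      by (simp add: step)
  qed
  also have "expectation (?W t) \<le> expectation (indicator (?A t))"
  proof (rule integral_mono)
    fix \<omega> assume "\<omega> \<in> space M"
    then show "?W t \<omega> \<le> indicator (?A t) \<omega>"
      using z by (auto simp: surviving_weight_def survival_def indicator_def power_le_one)
  qed (use int_W int_A in auto)
  finally show ?thesis
    by simp
qed

text \<open>
  The choice \<open>1 - z = k^(-1/2)\<close> makes \<open>\<psi>^k\<close> exceed \<open>1\<close> by at least the constant \<open>a\<close>, while the price
  \<open>1 - z^r\<close> is at most \<open>r k^(-1/2)\<close>. For \<open>k = 1\<close> it would give \<open>z = 0\<close> and leave \<open>\<psi>\<close> without meaning.
\<close>
lemma survival_bound:
  assumes iid: "iid_on M (count_space UNIV) X {1..}"
    and int: "integrable M (\<lambda>\<omega>. real (X 1 \<omega>))"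
    and mean: "expectation (\<lambda>\<omega>. real (X 1 \<omega>)) \<le> 1"
    and r: "r \<ge> 1" and k: "k \<ge> 2"
    and a: "a = prob {\<omega> \<in> space M. X 1 \<omega> = 0}" "a > 0"
  shows "prob (survival M X r k) \<le> real r * (1 + 1 / a) / sqrt (real k)"
proof -
  define u where "u = 1 / sqrt (real k)"
  define z where "z = 1 - u"
  define \<psi> where "\<psi> = expectation (\<lambda>\<omega>. z ^ X 1 \<omega>) / z"
  define p where "p = prob (survival M X r k)"
  have u: "0 < u" "u < 1" "real k * u\<^sup>2 = 1"
    using k by (auto simp: u_def power_divide)
  then have z: "0 < z" "z \<le> 1"
    by (auto simp: z_def)
  have X1: "X 1 \<in> measurable M (count_space UNIV)"
    using iid by (auto simp: iid_on_def indep_vars_def)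
  have \<psi>: "1 + a * u\<^sup>2 \<le> \<psi>"
    using generating_function_lower_bound[OF X1 int mean z] by (simp add: \<psi>_def a z_def)
  moreover have "0 \<le> a * u\<^sup>2"
    using a by simp
  ultimately have \<psi>1: "\<psi> \<ge> 1"
    by linarith
  define q where "q = \<psi> ^ k"
  have "1 + a = 1 + real k * (a * u\<^sup>2)"
    using u(3) by (metis mult.left_commute mult.right_neutral)
  also have "\<dots> \<le> (1 + a * u\<^sup>2) ^ k"
    using a by (intro Bernoulli_inequality) (smt (verit) zero_le_power2 mult_nonneg_nonneg)
  also have "\<dots> \<le> q"
    unfolding q_def using \<psi> \<open>0 \<le> a * u\<^sup>2\<close> by (intro power_mono) auto
  finally have q: "1 + a \<le> q" .
  have "1 + real r * (- u) \<le> (1 + (- u)) ^ r"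
    using u by (intro Bernoulli_inequality) simp
  then have zr: "1 - z ^ r \<le> real r * u"
    by (simp add: z_def)
  have "q * (z ^ r - 1 + p) \<le> p"
    unfolding q_def p_def
    by (rule survival_exponential_bound[OF iid r z \<psi>_def \<psi>1])
  then have "p * (q - 1) \<le> q * (1 - z ^ r)"
    by (simp add: algebra_simps)
  also have "\<dots> \<le> q * (real r * u)"
    using zr q a by (intro mult_left_mono) auto
  finally have "p \<le> real r * u * (q / (q - 1))"
    using q a by (simp add: field_simps)
  also have "q / (q - 1) \<le> 1 + 1 / a"
    using q a by (simp add: field_simps)
  then have "real r * u * (q / (q - 1)) \<le> real r * u * (1 + 1 / a)"
    using u by (intro mult_left_mono) auto
  finally show ?thesis
    by (simp add: p_def u_def field_simps)
qed

end

section \<open>Elimination of the mass at zero\<close>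

theorem lemma2p14:
  fixes M :: "'a measure" and X :: "nat \<Rightarrow> 'a \<Rightarrow> nat" and r k :: nat
  assumes "prob_space M"
    and "iid_on M (count_space UNIV) X {1..}"
    and "finite_variance M (\<lambda>\<omega>. real (X 1 \<omega>))"
    and "prob_space.expectation M (\<lambda>\<omega>. real (X 1 \<omega>)) \<le> 1"
    and "r \<ge> 1"
    and "prob_space.prob M {\<omega> \<in> space M. X 1 \<omega> = r + 1} > 0"
    and "k \<ge> 1"
  shows "prob_space.prob M {\<omega> \<in> space M. \<forall>t\<in>{1..k}. int r + step_walk X t \<omega> > 0}
    \<le> inverse (prob_space.prob M {\<omega> \<in> space M. X 1 \<omega> = r + 1})
        * (1 + 2 * prob_space.variance M (\<lambda>\<omega>. real (X 1 \<omega>))) / sqrt (real k)"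
proof -
  interpret prob_space M by fact
  define q where "q = prob {\<omega> \<in> space M. X 1 \<omega> = r + 1}"
  define a where "a = prob {\<omega> \<in> space M. X 1 \<omega> = 0}"
  define V where "V = variance (\<lambda>\<omega>. real (X 1 \<omega>))"
  have X1: "X 1 \<in> measurable M (count_space UNIV)"
    using assms(2) by (auto simp: iid_on_def indep_vars_def)
  have int: "integrable M (\<lambda>\<omega>. real (X 1 \<omega>))"
    using assms(3) by (simp add: finite_variance_def)
  have q: "0 < q" "q \<le> 1"
    using assms(6) by (auto simp: q_def)
  have rqa: "real r * q \<le> a"
    unfolding q_def a_def by (rule upward_mass_le_prob_zero[OF X1 int assms(4)])
  have rqV: "real r * q \<le> V"
    unfolding q_def V_def by (rule upward_mass_le_variance[OF X1 assms(3,4)])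
  have rq: "0 < real r * q"
    using q assms(5) by simp
  have "prob (survival M X r k) \<le> inverse q * (1 + 2 * V) / sqrt (real k)"
  proof (cases "k = 1")
    case True
    have "prob (survival M X r k) \<le> 1"
      by simp
    also have "1 \<le> inverse q * (1 + 2 * V)"
      using q rqV rq by (simp add: field_simps)
    finally show ?thesis
      using True by simp
  next
    case False
    have "prob (survival M X r k) \<le> real r * (1 + 1 / a) / sqrt (real k)"
      by (rule survival_bound[OF assms(2) int assms(4,5)]) (use False assms(7) rqa rq in \<open>auto simp: a_def\<close>)
    also have "real r * (1 + 1 / a) \<le> inverse q * (1 + 2 * V)"
    proof -
      have "real r * q * (1 + 1 / a) = real r * q + real r * q / a"
        by (simp add: algebra_simps)
      also have "\<dots> \<le> V + 1"
        using rqa rqV rq by (intro add_mono) auto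
      also have "\<dots> \<le> 1 + 2 * V"
        using rqV rq by simp
      finally show ?thesis
        using q by (simp add: field_simps)
    qed
    then have "real r * (1 + 1 / a) / sqrt (real k) \<le> inverse q * (1 + 2 * V) / sqrt (real k)"
      by (rule divide_right_mono) simp
    finally show ?thesis .
  qed
  then show ?thesis
    unfolding survival_def q_def V_def .
qed

end
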